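(* Let $G$ be a separable metrisable topological group. Then $G$ admits a metrically proper compatible left-invariant metric if and only if $G$ has the local property (OB), i.e., there is a neighbourhood of the identity having property (OB) relative to $G$.
   Context: A metrisable topological group is a topological group whose topology can be induced by some metric. A metric $d$ on $G$ is compatible if it induces the topology of $G$, and left-invariant if $d(hg,hf)=d(g,f)$ for all $g,f,h\in G$. A subset $A\subseteq G$ has property (OB) relative to $G$ if $A$ has finite diameter with respect to every compatible left-invariant metric on $G$. A sequence $(g_n)$ in $G$ tends to infinity, written $g_n\to\infty$, if there is a compatible left-invariant metric $\partial$ on $G$ with $\partial(g_n,1)\to\infty$. A compatible left-invariant metric $d$ on $G$ is metrically proper if $d(g_n,1)\to\infty$ whenever $g_n\to\infty$ (equivalently, every subset of $G$ of finite $d$-diameter has property (OB) relative to $G$). *)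

theory Defs
  imports "HOL-Analysis.Analysis"
begin

text \<open>
  The class \<open>topological_group_add\<close> does not assume commutativity: \<open>g + h\<close> stands for the
  product \<open>gh\<close> and \<open>0\<close> for the identity \<open>1\<close>. Metrics are explicit functions rather than the
  class operation \<open>dist\<close>, since the definitions quantify over all metrics on the same group.
\<close>

definition compatible_metric :: "('a::topological_space \<Rightarrow> 'a \<Rightarrow> real) \<Rightarrow> bool" where
  "compatible_metric d \<longleftrightarrow>
     Metric_space UNIV d \<and> Metric_space.mtopology UNIV d = euclidean"

definition left_invariant :: "('a::plus \<Rightarrow> 'a \<Rightarrow> real) \<Rightarrow> bool" where
  "left_invariant d \<longleftrightarrow> (\<forall>h g f. d (h + g) (h + f) = d g f)"

definition finite_diameter :: "('a \<Rightarrow> 'a \<Rightarrow> real) \<Rightarrow> 'a set \<Rightarrow> bool" where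
  "finite_diameter d A \<longleftrightarrow> (\<exists>B. \<forall>x\<in>A. \<forall>y\<in>A. d x y \<le> B)"

definition property_OB :: "'a::topological_group_add set \<Rightarrow> bool" where
  "property_OB A \<longleftrightarrow>
     (\<forall>d. compatible_metric d \<longrightarrow> left_invariant d \<longrightarrow> finite_diameter d A)"

definition local_property_OB :: "'a::topological_group_add itself \<Rightarrow> bool" where
  "local_property_OB _ \<longleftrightarrow> (\<exists>U::'a set. 0 \<in> interior U \<and> property_OB U)"

definition tends_to_infinity :: "(nat \<Rightarrow> 'a::topological_group_add) \<Rightarrow> bool" where
  "tends_to_infinity g \<longleftrightarrow>
     (\<exists>d. compatible_metric d \<and> left_invariant d \<and>
          filterlim (\<lambda>n. d (g n) 0) at_top sequentially)"

definition metrically_proper :: "('a::topological_group_add \<Rightarrow> 'a \<Rightarrow> real) \<Rightarrow> bool" where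
  "metrically_proper d \<longleftrightarrow>
     (\<forall>g. tends_to_infinity g \<longrightarrow> filterlim (\<lambda>n. d (g n) 0) at_top sequentially)"

end

theory Submission
  imports Defs
begin

text \<open>
  Given an OB neighbourhood of the identity, build symmetric identity neighbourhoods \<open>V n\<close>
  (\<open>n\<close> an integer) with \<open>V n + V n + V n \<subseteq> V (n + 1)\<close>: for \<open>n \<rightarrow> - \<infinity>\<close> they shrink to a basis at
  the identity inside the OB neighbourhood, and for \<open>n \<ge> 0\<close> they are enlarged by successively
  throwing in the points of a countable dense set, so that they stay OB and exhaust the group.
  The Birkhoff--Kakutani construction, applied to this two-sided chain, gives a length function
  with \<open>{g. N g < 2^n} \<subseteq> V n \<subseteq> {g. N g \<le> 2^n}\<close>. Hence the metric is compatible by the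
  behaviour at \<open>- \<infinity>\<close>, and bounded sets are OB by the behaviour at \<open>+ \<infinity>\<close>.
\<close>

section \<open>Property (OB)\<close>

lemma left_invariant_length_add:
  fixes d :: "'a::topological_group_add \<Rightarrow> 'a \<Rightarrow> real"
  assumes "compatible_metric d" "left_invariant d"
  shows "d (x + y) 0 \<le> d x 0 + d y 0"
proof -
  interpret Metric_space UNIV d
    using assms by (simp add: compatible_metric_def)
  have "d (x + y) (x + 0) = d y 0"
    using assms(2) unfolding left_invariant_def by blast
  then show ?thesis
    using triangle[of "x + y" x 0] by simp
qed

text \<open>By the triangle inequality, bounded diameter amounts to bounded distance from one fixed
  point. Choosing the identity brings in the length \<open>d x 0\<close>, which is subadditive when
  \<open>d\<close> is left-invariant.\<close>

lemma property_OB_iff: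
  "property_OB (A :: 'a::topological_group_add set) \<longleftrightarrow>
     (\<forall>d. compatible_metric d \<longrightarrow> left_invariant d \<longrightarrow> (\<exists>B. \<forall>x\<in>A. d x 0 \<le> B))"
proof -
  have "finite_diameter d A \<longleftrightarrow> (\<exists>B. \<forall>x\<in>A. d x 0 \<le> B)" if "compatible_metric d" for d
  proof -
    interpret Metric_space UNIV d
      using that by (simp add: compatible_metric_def)
    show ?thesis
    proof
      assume "finite_diameter d A"
      then obtain B where B: "\<And>x y. x \<in> A \<Longrightarrow> y \<in> A \<Longrightarrow> d x y \<le> B"
        unfolding finite_diameter_def by blast
      show "\<exists>B. \<forall>x\<in>A. d x 0 \<le> B"
      proof (cases "A = {}")
        case False
        then obtain a where "a \<in> A" by blast
        then have "d x 0 \<le> B + d a 0" if "x \<in> A" for x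
          using B[OF that \<open>a \<in> A\<close>] triangle[of x a 0] by simp
        then show ?thesis by blast
      qed simp
    next
      assume "\<exists>B. \<forall>x\<in>A. d x 0 \<le> B"
      then obtain B where B: "\<And>x. x \<in> A \<Longrightarrow> d x 0 \<le> B" by blast
      have "d x y \<le> B + B" if "x \<in> A" "y \<in> A" for x y
        using B[OF that(1)] B[OF that(2)] triangle[of x 0 y] commute[of 0 y] by simp
      then show "finite_diameter d A"
        unfolding finite_diameter_def by blast
    qed
  qed
  then show ?thesis
    unfolding property_OB_def by blast
qed

lemma property_OB_subset: "property_OB A" if "property_OB B" "A \<subseteq> B"
  using that unfolding property_OB_def finite_diameter_def by blast

lemma property_OB_Un_finite:
  fixes A :: "'a::topological_group_add set"
  assumes "property_OB A" "finite F"
  shows "property_OB (A \<union> F)"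
  unfolding property_OB_iff
proof (intro allI impI)
  fix d :: "'a \<Rightarrow> 'a \<Rightarrow> real"
  assume "compatible_metric d" "left_invariant d"
  then obtain B where B: "\<And>x. x \<in> A \<Longrightarrow> d x 0 \<le> B"
    using assms(1) unfolding property_OB_iff by blast
  obtain C where C: "\<And>x. x \<in> F \<Longrightarrow> d x 0 \<le> C"
    using bdd_above_finite[of "(\<lambda>x. d x 0) ` F"] assms(2) unfolding bdd_above_def by auto
  have "d x 0 \<le> max B C" if "x \<in> A \<union> F" for x
    using that B[of x] C[of x] by (auto simp: le_max_iff_disj)
  then show "\<exists>B. \<forall>x\<in>A \<union> F. d x 0 \<le> B"
    by blast
qed

text \<open>Three factors rather than two, because the cutting argument for words splits a word into
  a prefix, one letter and a suffix.\<close>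

definition triple_sum :: "'a::plus set \<Rightarrow> 'a set" where
  "triple_sum A = {a + b + c | a b c. a \<in> A \<and> b \<in> A \<and> c \<in> A}"

lemma triple_sumI: "a \<in> A \<Longrightarrow> b \<in> A \<Longrightarrow> c \<in> A \<Longrightarrow> a + b + c \<in> triple_sum A"
  unfolding triple_sum_def by blast

lemma triple_sum_mono: "A \<subseteq> B \<Longrightarrow> triple_sum A \<subseteq> triple_sum B"
  unfolding triple_sum_def by blast

lemma subset_triple_sum:
  fixes A :: "'a::monoid_add set"
  assumes "0 \<in> A"
  shows "A \<subseteq> triple_sum A"
  using triple_sumI[OF _ assms assms] by auto

lemma uminus_triple_sum:
  fixes A :: "'a::group_add set"
  assumes "\<And>x. x \<in> A \<Longrightarrow> - x \<in> A" "x \<in> triple_sum A"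
  shows "- x \<in> triple_sum A"
proof -
  obtain a b c where "x = a + b + c" and abc: "a \<in> A" "b \<in> A" "c \<in> A"
    using assms(2) unfolding triple_sum_def by blast
  then have "- x = - c + - b + - a"
    by (simp only: minus_add add.assoc)
  with abc show ?thesis
    using triple_sumI assms(1) by metis
qed

text \<open>Lengths are subadditive, so a bound \<open>B\<close> on \<open>A\<close> gives the bound
  \<open>3B\<close> on triple sums.\<close>

lemma property_OB_triple_sum:
  fixes A :: "'a::topological_group_add set"
  assumes "property_OB A"
  shows "property_OB (triple_sum A)"
  unfolding property_OB_iff
proof (intro allI impI)
  fix d :: "'a \<Rightarrow> 'a \<Rightarrow> real"
  assume d: "compatible_metric d" "left_invariant d"
  then obtain B where B: "\<And>x. x \<in> A \<Longrightarrow> d x 0 \<le> B"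
    using assms unfolding property_OB_iff by blast
  have "d (a + b + c) 0 \<le> B + B + B" if "a \<in> A" "b \<in> A" "c \<in> A" for a b c
    using left_invariant_length_add[OF d, of "a + b" c] left_invariant_length_add[OF d, of a b]
      B[OF that(1)] B[OF that(2)] B[OF that(3)] by linarith
  then show "\<exists>B. \<forall>x\<in>triple_sum A. d x 0 \<le> B"
    unfolding triple_sum_def by blast
qed

text \<open>The open unit ball of \<open>d\<close> serves as the neighbourhood. If a compatible
  left-invariant \<open>e\<close> were unbounded on it, \<open>e\<close> would witness a sequence in
  the ball tending to infinity, although its \<open>d\<close>-length stays below 1.\<close>

lemma proper_imp_local_OB:
  fixes d :: "'a::topological_group_add \<Rightarrow> 'a \<Rightarrow> real"
  assumes d: "compatible_metric d" "left_invariant d" and "metrically_proper d"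
  shows "local_property_OB TYPE('a)"
proof -
  interpret Metric_space UNIV d
    using d by (simp add: compatible_metric_def)
  have "openin mtopology (mball 0 1)"
    by (rule openin_mball)
  then have "open (mball 0 1)"
    using d by (simp only: compatible_metric_def open_openin)
  moreover have "0 \<in> mball 0 1"
    by simp
  moreover have "property_OB (mball 0 1)"
    unfolding property_OB_iff
  proof (intro allI impI, rule ccontr)
    fix e :: "'a \<Rightarrow> 'a \<Rightarrow> real"
    assume e: "compatible_metric e" "left_invariant e" and "\<nexists>B. \<forall>x\<in>mball 0 1. e x 0 \<le> B"
    then have "\<forall>n. \<exists>x. x \<in> mball 0 1 \<and> e x 0 \<ge> real n"
      by (meson linear)
    then obtain g where g: "\<And>n. g n \<in> mball 0 1" "\<And>n. e (g n) 0 \<ge> real n"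
      by metis
    then have "filterlim (\<lambda>n. e (g n) 0) at_top sequentially"
      using filterlim_at_top_mono[OF filterlim_real_sequentially] by simp
    with e assms(3) have "filterlim (\<lambda>n. d (g n) 0) at_top sequentially"
      unfolding metrically_proper_def tends_to_infinity_def by blast
    then have "eventually (\<lambda>n. d (g n) 0 \<ge> 1) sequentially"
      by (simp add: filterlim_at_top)
    then obtain n where "d (g n) 0 \<ge> 1"
      by (auto simp: eventually_sequentially)
    then show False
      using g(1)[of n] commute[of 0 "g n"] by simp
  qed
  ultimately show ?thesis
    unfolding local_property_OB_def by (metis interior_open)
qed

section \<open>The metric of a two-sided chain of neighbourhoods\<close>

text \<open>Each letter carries the index of a set of the chain, and only the index is charged; one
  element can thus occur at several costs.\<close>

definition chain_weight :: "('a \<times> int) list \<Rightarrow> real" where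
  "chain_weight l = (\<Sum>p\<leftarrow>l. 2 powi snd p)"

lemma chain_weight_simps [simp]:
  "chain_weight [] = 0"
  "chain_weight (p # l) = 2 powi snd p + chain_weight l"
  "chain_weight (l @ l') = chain_weight l + chain_weight l'"
  by (simp_all add: chain_weight_def)

lemma chain_weight_nonneg: "0 \<le> chain_weight l"
  by (induction l) auto

text \<open>\<open>basis\<close> and \<open>separated\<close> control the shrinking end,
  \<open>exhaust\<close> the growing end. \<open>separated\<close> is the Hausdorff property, which
  the class \<open>topological_group_add\<close> does not include.\<close>

locale two_sided_chain =
  fixes V :: "int \<Rightarrow> 'a::topological_group_add set"
  assumes uminus: "x \<in> V n \<Longrightarrow> - x \<in> V n"
    and triple: "triple_sum (V n) \<subseteq> V (n + 1)"
    and zero_interior: "0 \<in> interior (V n)"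
    and exhaust: "\<exists>n. x \<in> V n"
    and basis: "open W \<Longrightarrow> 0 \<in> W \<Longrightarrow> \<exists>n. V n \<subseteq> W"
    and separated: "x \<noteq> 0 \<Longrightarrow> \<exists>n. x \<notin> V n"
begin

section \<open>Words over the chain and the length function\<close>

definition words :: "'a \<Rightarrow> ('a \<times> int) list set" where
  "words x = {l. (\<forall>p\<in>set l. fst p \<in> V (snd p)) \<and> sum_list (map fst l) = x}"

text \<open>By \<open>exhaust\<close> every element is spelled by some word, and weights are
  nonnegative, so this infimum is a genuine one.\<close>

definition len :: "'a \<Rightarrow> real" where
  "len x = (INF l\<in>words x. chain_weight l)"

lemma zero: "0 \<in> V n"
  using zero_interior interior_subset by blast

lemma mono: "m \<le> n \<Longrightarrow> V m \<subseteq> V n"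
proof (induction n rule: int_ge_induct)
  case (step n)
  then show ?case
    using subset_triple_sum[OF zero, of n] triple[of n] by blast
qed simp

text \<open>
  Cut the word at the first letter where the partial weight reaches \<open>2^(n-1)\<close>: the prefix, the
  letter and the suffix all lie in \<open>V (n - 1)\<close>.
\<close>

lemma word_in_chain:
  assumes "\<forall>p\<in>set l. fst p \<in> V (snd p)" "chain_weight l < 2 powi n"
  shows "sum_list (map fst l) \<in> V n"
  using assms
proof (induction "length l" arbitrary: l n rule: less_induct)
  case less
  have half: "(2::real) powi n = 2 powi (n - 1) + 2 powi (n - 1)"
    using power_int_add_1[of "2::real" "n - 1"] by simp
  show ?case
  proof (cases "l = []")
    case True
    then show ?thesis by (simp add: zero)
  next
    case False
    define P where "P k \<longleftrightarrow> k \<le> length l \<and> chain_weight (take k l) < 2 powi (n - 1)" for k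
    \<comment> \<open>If the whole word weighs less than \<open>2 powi (n - 1)\<close>, no letter
      crosses the threshold; the last letter is then cut off and the suffix is empty. In both cases
      prefix and suffix are shorter than \<open>l\<close>, as the induction requires.\<close>
    define j where "j = (if P (length l) then length l - 1 else (GREATEST k. P k))"
    have "P j \<and> j < length l \<and> (P (Suc j) \<longrightarrow> Suc j = length l)"
    proof (cases "P (length l)")
      case True
      have "chain_weight l = chain_weight (take j l) + chain_weight (drop j l)"
        using chain_weight_simps(3)[of "take j l" "drop j l"] by simp
      then have "P j"
        using True chain_weight_nonneg[of "drop j l"] unfolding P_def j_def by auto
      then show ?thesis
        using True False by (auto simp: j_def)
    next
      case False
      have "P 0"
        by (simp add: P_def)
      then have "P j" and "\<And>k. P k \<Longrightarrow> k \<le> j"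
        using False GreatestI_nat[of P 0 "length l"] Greatest_le_nat[of P _ "length l"]
        by (auto simp: j_def P_def)
      then show ?thesis
        using False by (metis P_def Suc_n_not_le_n le_neq_implies_less)
    qed
    then have j: "P j" "j < length l" "P (Suc j) \<Longrightarrow> Suc j = length l"
      by auto
    define a b c where "a = take j l" and "b = l ! j" and "c = drop (Suc j) l"
    have l: "l = a @ b # c"
      using j(2) by (simp add: a_def b_def c_def id_take_nth_drop)
    have wa: "chain_weight a < 2 powi (n - 1)"
      using j(1) by (simp add: P_def a_def)
    have wc: "chain_weight c < 2 powi (n - 1)"
    proof (cases "P (Suc j)")
      case True
      then show ?thesis
        using j(3) by (simp add: c_def)
    next
      case False
      \<comment> \<open>Prefix and letter use up at least half of \<open>2 powi n\<close>, so less
        than half is left for the suffix.\<close>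
      then have "chain_weight (a @ [b]) \<ge> 2 powi (n - 1)"
        using j(2) by (simp add: P_def a_def b_def take_Suc_conv_app_nth)
      then show ?thesis
        using less.prems(2) half by (simp add: l)
    qed
    \<comment> \<open>Exponents are integers, so a letter weighing strictly less than
      \<open>2 powi n\<close> has index at most \<open>n - 1\<close>.\<close>
    have "(2::real) powi snd b < 2 powi n"
      using less.prems(2) chain_weight_nonneg[of a] chain_weight_nonneg[of c] by (simp add: l)
    then have "snd b \<le> n - 1"
      using power_int_increasing[of n "snd b" "2::real"] by (cases "snd b \<le> n - 1") auto
    then have "fst b \<in> V (n - 1)"
      using less.prems(1) mono[of "snd b" "n - 1"] l by auto
    moreover have "sum_list (map fst a) \<in> V (n - 1)" "sum_list (map fst c) \<in> V (n - 1)"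
      using less.hyps[OF _ _ wa] less.hyps[OF _ _ wc] less.prems(1) by (auto simp: l)
    ultimately have "sum_list (map fst a) + fst b + sum_list (map fst c) \<in> triple_sum (V (n - 1))"
      by (intro triple_sumI)
    then show ?thesis
      using triple[of "n - 1"] by (auto simp: l add.assoc)
  qed
qed

lemma singleton_word: "x \<in> V n \<Longrightarrow> [(x, n)] \<in> words x"
  by (simp add: words_def)

lemma words_nonempty: "words x \<noteq> {}"
  using exhaust singleton_word by blast

lemma append_words: "l \<in> words x \<Longrightarrow> l' \<in> words y \<Longrightarrow> l @ l' \<in> words (x + y)"
  by (auto simp: words_def)

lemma bdd_below_words: "bdd_below (chain_weight ` words x)"
  by (rule bdd_belowI2) (rule chain_weight_nonneg)

lemma len_le: "l \<in> words x \<Longrightarrow> len x \<le> chain_weight l"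
  unfolding len_def by (rule cINF_lower[OF bdd_below_words])

lemma le_len: "(\<And>l. l \<in> words x \<Longrightarrow> r \<le> chain_weight l) \<Longrightarrow> r \<le> len x"
  unfolding len_def by (rule cINF_greatest[OF words_nonempty])

lemma len_nonneg: "0 \<le> len x"
  by (intro le_len chain_weight_nonneg)

lemma len_le_powi: "x \<in> V n \<Longrightarrow> len x \<le> 2 powi n"
  using len_le[OF singleton_word] by simp

text \<open>A word for \<open>x\<close> lighter than \<open>2 powi n\<close> would put
  \<open>x\<close> into \<open>V n\<close> by \<open>word_in_chain\<close>.\<close>

lemma powi_le_len: "x \<notin> V n \<Longrightarrow> 2 powi n \<le> len x"
  using word_in_chain by (intro le_len) (force simp: words_def)

lemma len_zero: "len 0 = 0"
  using len_le[of "[]" 0] len_nonneg[of 0] by (simp add: words_def)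

lemma len_eq_0_iff: "len x = 0 \<longleftrightarrow> x = 0"
  using separated powi_le_len len_zero zero_less_power_int[of "2::real"]
  by (metis leD zero_less_numeral)

lemma len_add: "len (x + y) \<le> len x + len y"
proof -
  \<comment> \<open>The word for \<open>y\<close> is fixed while the infimum over the words for
    \<open>x\<close> is taken; the infimum over the words for \<open>y\<close> follows.\<close>
  have "len (x + y) - chain_weight l' \<le> len x" if "l' \<in> words y" for l'
    using len_le[OF append_words[OF _ that]] by (intro le_len) (fastforce simp: algebra_simps)
  then have "len (x + y) - len x \<le> len y"
    by (intro le_len) (fastforce simp: algebra_simps)
  then show ?thesis by simp
qed

text \<open>Reversing a word and negating its letters, with indices kept, spells the inverse at the
  same weight because each \<open>V n\<close> is symmetric. This gives one inequality; applying it
  to \<open>- x\<close> gives the other.\<close>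

lemma len_uminus: "len (- x) = len x"
proof -
  have reverse: "\<exists>l'\<in>words (- x). chain_weight l' = chain_weight l" if "l \<in> words x" for l x
    using that
  proof (induction l arbitrary: x)
    case Nil
    then show ?case
      by (intro bexI[of _ "[]"]) (auto simp: words_def)
  next
    case (Cons p l)
    then have "l \<in> words (- fst p + x)" "fst p \<in> V (snd p)"
      by (auto simp: words_def add.assoc[symmetric])
    moreover from Cons.IH[OF this(1)] obtain l' where
      "l' \<in> words (- (- fst p + x))" "chain_weight l' = chain_weight l" by blast
    ultimately have "l' @ [(- fst p, snd p)] \<in> words (- (- fst p + x) + - fst p)"
      by (intro append_words singleton_word uminus)
    then show ?case
      using \<open>chain_weight l' = chain_weight l\<close>
      by (intro bexI[of _ "l' @ [(- fst p, snd p)]"]) (auto simp: minus_add add.assoc)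
  qed
  have "len (- x) \<le> len x" for x
    using reverse len_le by (metis le_len)
  from this[of x] this[of "- x"] show ?thesis
    by simp
qed

section \<open>The left-invariant metric induced by the length\<close>

definition chain_dist :: "'a \<Rightarrow> 'a \<Rightarrow> real" where
  "chain_dist x y = len (- x + y)"

lemma left_invariant_chain_dist: "left_invariant chain_dist"
proof -
  have "- (h + g) + (h + f) = - g + f" for h g f :: 'a
    by (simp only: minus_add add.assoc minus_add_cancel)
  then show ?thesis
    by (simp add: left_invariant_def chain_dist_def)
qed

lemma Metric_space_chain_dist: "Metric_space UNIV chain_dist"
proof
  fix x y z :: 'a
  show "0 \<le> chain_dist x y"
    by (simp add: chain_dist_def len_nonneg)
  have "- (- x + y) = - y + x"
    by (simp add: minus_add)
  then show "chain_dist x y = chain_dist y x"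
    unfolding chain_dist_def using len_uminus[of "- x + y"] by simp
  show "chain_dist x y = 0 \<longleftrightarrow> x = y"
    by (auto simp: chain_dist_def len_eq_0_iff neg_eq_iff_add_eq_0 add_eq_0_iff)
  have "- x + z = (- x + y) + (- y + z)"
    by (simp add: add.assoc)
  then show "chain_dist x z \<le> chain_dist x y + chain_dist y z"
    unfolding chain_dist_def using len_add[of "- x + y" "- y + z"] by simp
qed

lemma powi_arbitrarily_small: "0 < r \<Longrightarrow> \<exists>n. (2::real) powi n < r"
proof -
  assume "0 < r"
  then obtain k where "(1 / 2 :: real) ^ k < r"
    using real_arch_pow_inv[of r "1 / 2"] by auto
  then have "(2::real) powi (- int k) < r"
    by (simp add: power_int_minus power_one_over inverse_eq_divide)
  then show ?thesis by blast
qed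

text \<open>The ball of radius \<open>2 powi n\<close> about \<open>x\<close> lies in the translate
  of \<open>V n\<close> by \<open>x\<close>, and every ball of radius \<open>r > 2 powi n\<close>
  contains that translate. The first inclusion combines with \<open>basis\<close>, the second with
  \<open>zero_interior\<close>.\<close>

lemma compatible_chain_dist: "compatible_metric chain_dist"
proof -
  interpret Metric_space UNIV chain_dist
    by (rule Metric_space_chain_dist)
  have translate_open: "open {v. x + v \<in> W}" if "open W" for x and W :: "'a set"
  proof -
    have "open ((\<lambda>v. x + v) -` W)"
      using that by (intro open_vimage continuous_intros)
    then show ?thesis
      by (simp add: vimage_def)
  qed
  have "openin mtopology U \<longleftrightarrow> open U" for U
  proof
    assume "open U"
    have "\<exists>r>0. mball x r \<subseteq> U" if "x \<in> U" for x
    proof -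
      obtain n where n: "V n \<subseteq> {v. x + v \<in> U}"
        using basis[OF translate_open[OF \<open>open U\<close>], of x] \<open>x \<in> U\<close> by auto
      have "y \<in> U" if "y \<in> mball x (2 powi n)" for y
      proof -
        have "- x + y \<in> V n"
          using that powi_le_len[of "- x + y" n] by (auto simp: chain_dist_def)
        then show ?thesis
          using n by (auto simp: add.assoc[symmetric])
      qed
      then show ?thesis
        by (intro exI[of _ "2 powi n"]) auto
    qed
    then show "openin mtopology U"
      by (auto simp: openin_mtopology)
  next
    assume U: "openin mtopology U"
    show "open U"
    proof (subst open_subopen, intro ballI)
      fix x assume "x \<in> U"
      then obtain r where "r > 0" and r: "mball x r \<subseteq> U"
        using U by (auto simp: openin_mtopology)
      then obtain n where n: "2 powi n < r"
        using powi_arbitrarily_small by blast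
      let ?T = "{v. - x + v \<in> interior (V n)}"
      have "open ?T"
        by (intro translate_open open_interior)
      moreover have "x \<in> ?T"
        using zero_interior by simp
      moreover have "?T \<subseteq> mball x r"
        using n len_le_powi interior_subset[of "V n"] by (fastforce simp: chain_dist_def)
      ultimately show "\<exists>T. open T \<and> x \<in> T \<and> T \<subseteq> U"
        using r by blast
    qed
  qed
  then have "mtopology = euclidean"
    by (simp add: topology_eq)
  then show ?thesis
    using Metric_space_chain_dist by (simp add: compatible_metric_def)
qed

text \<open>A metric \<open>d\<close> witnessing that \<open>g\<close> tends to infinity is bounded
  on each \<open>V k\<close>, so \<open>g n\<close> eventually lies outside \<open>V k\<close> and
  has length at least \<open>2 powi k\<close>.\<close>

lemma metrically_proper_chain_dist:
  assumes OB: "\<And>n. property_OB (V n)"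
  shows "metrically_proper chain_dist"
  unfolding metrically_proper_def
proof (intro allI impI)
  fix g :: "nat \<Rightarrow> 'a"
  assume "tends_to_infinity g"
  then obtain d where d: "compatible_metric d" "left_invariant d"
    and lim: "filterlim (\<lambda>n. d (g n) 0) at_top sequentially"
    unfolding tends_to_infinity_def by blast
  show "filterlim (\<lambda>n. chain_dist (g n) 0) at_top sequentially"
    unfolding filterlim_at_top
  proof
    fix Z :: real
    obtain k where "Z < 2 ^ k"
      using real_arch_pow[of 2 Z] by auto
    then have k: "Z < 2 powi int k"
      by simp
    obtain B where B: "\<And>x. x \<in> V (int k) \<Longrightarrow> d x 0 \<le> B"
      using OB d unfolding property_OB_iff by blast
    have "eventually (\<lambda>n. B + 1 \<le> d (g n) 0) sequentially"
      using lim by (simp add: filterlim_at_top)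
    then show "eventually (\<lambda>n. Z \<le> chain_dist (g n) 0) sequentially"
    proof eventually_elim
      case (elim n)
      then have "g n \<notin> V (int k)"
        using B[of "g n"] by linarith
      then show ?case
        using powi_le_len k by (fastforce simp: chain_dist_def len_uminus)
    qed
  qed
qed

end

section \<open>Existence of an exhausting chain of OB neighbourhoods\<close>

text \<open>Continuity of addition at the identity is used twice: sums from \<open>Z2\<close> lie in
  \<open>Z1\<close>, sums from \<open>Z1\<close> lie in \<open>W\<close>. The third factor lies in
  \<open>Z1\<close> as well, since \<open>Z2 \<subseteq> Z1\<close>. Intersecting \<open>Z2\<close>
  with its inverse gives symmetry.\<close>

lemma open_symmetric_triple_sum_subset:
  fixes W :: "'a::topological_group_add set"
  assumes "open W" "0 \<in> W"
  obtains Z where "open Z" "0 \<in> Z" "\<And>x. x \<in> Z \<Longrightarrow> - x \<in> Z" "triple_sum Z \<subseteq> W"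
proof -
  have halve: "\<exists>Z. open Z \<and> 0 \<in> Z \<and> (\<forall>x\<in>Z. \<forall>y\<in>Z. x + y \<in> W)"
    if "open W" "0 \<in> W" for W :: "'a set"
  proof -
    have "((\<lambda>p. fst p + snd p) \<longlongrightarrow> (0 + 0)) (nhds 0 \<times>\<^sub>F nhds (0::'a))"
      by (intro tendsto_add filterlim_fst filterlim_snd)
    then have "eventually (\<lambda>p. fst p + snd p \<in> W) (nhds 0 \<times>\<^sub>F nhds 0)"
      using that by (auto simp: tendsto_def)
    then obtain P Q where PQ: "eventually P (nhds 0)" "eventually Q (nhds 0)"
      "\<And>x y. P x \<Longrightarrow> Q y \<Longrightarrow> x + y \<in> W"
      unfolding eventually_prod_filter by auto
    then have "eventually (\<lambda>x. P x \<and> Q x) (nhds 0)"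
      by (intro eventually_conj)
    then obtain Z where "open Z" "0 \<in> Z" "\<And>x. x \<in> Z \<Longrightarrow> P x \<and> Q x"
      unfolding eventually_nhds by blast
    then show ?thesis
      using PQ(3) by (intro exI[of _ Z]) blast
  qed
  obtain Z1 where Z1: "open Z1" "0 \<in> Z1" "\<And>x y. x \<in> Z1 \<Longrightarrow> y \<in> Z1 \<Longrightarrow> x + y \<in> W"
    using halve[OF assms] by blast
  obtain Z2 where Z2: "open Z2" "0 \<in> Z2" "\<And>x y. x \<in> Z2 \<Longrightarrow> y \<in> Z2 \<Longrightarrow> x + y \<in> Z1"
    using halve[OF Z1(1,2)] by blast
  define Z where "Z = Z2 \<inter> uminus -` Z2"
  have "open (uminus -` Z2)"
    using Z2(1) by (intro open_vimage continuous_intros)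
  then have "open Z" "0 \<in> Z" "\<And>x. x \<in> Z \<Longrightarrow> - x \<in> Z"
    using Z2 by (auto simp: Z_def)
  moreover have "triple_sum Z \<subseteq> W"
  proof -
    have "c \<in> Z1" if "c \<in> Z2" for c
      using Z2(3)[OF that Z2(2)] by simp
    then show ?thesis
      using Z1(3) Z2(3) by (auto simp: triple_sum_def Z_def)
  qed
  ultimately show thesis
    using that by blast
qed

section \<open>Countable data from metrisability and separability\<close>

lemma metrizable_countable_basis_0:
  assumes "metrizable_space (euclidean :: 'a::topological_group_add topology)"
  obtains B :: "nat \<Rightarrow> 'a::topological_group_add set" where "\<And>n. open (B n)" "\<And>n. 0 \<in> B n"
    "\<And>W. open W \<Longrightarrow> 0 \<in> W \<Longrightarrow> \<exists>n. B n \<subseteq> W" "\<And>x. x \<noteq> 0 \<Longrightarrow> \<exists>n. x \<notin> B n"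
proof -
  obtain M :: "'a set" and m where "Metric_space M m" and top: "euclidean = Metric_space.mtopology M m"
    using assms unfolding metrizable_space_def by blast
  then interpret Metric_space M m by simp
  have M: "M = UNIV"
    using top topspace_mtopology by (metis topspace_euclidean)
  let ?B = "\<lambda>n. mball 0 (inverse (real (Suc n)))"
  show thesis
  proof (rule that[of ?B])
    fix n
    show "open (?B n)"
      using openin_mball by (simp add: open_openin top)
    show "0 \<in> ?B n"
      by (subst centre_in_mball_iff) (simp add: M)
  next
    fix W :: "'a set" assume "open W" "0 \<in> W"
    then obtain r where "r > 0" "mball 0 r \<subseteq> W"
      by (auto simp: open_openin top openin_mtopology)
    moreover obtain n where "inverse (real (Suc n)) < r"
      using reals_Archimedean[OF \<open>r > 0\<close>] by blast
    ultimately show "\<exists>n. ?B n \<subseteq> W"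
      using mball_subset_concentric[of "inverse (real (Suc n))" r 0] by (meson less_imp_le subset_trans)
  next
    fix x :: 'a assume "x \<noteq> 0"
    then have "m 0 x > 0"
      by (simp add: M)
    then obtain n where "inverse (real (Suc n)) < m 0 x"
      using reals_Archimedean by blast
    then show "\<exists>n. x \<notin> ?B n"
      by (intro exI[of _ n]) auto
  qed
qed

lemma separable_dense_sequence:
  assumes "separable_space (euclidean :: 'a::topological_space topology)"
  obtains s :: "nat \<Rightarrow> 'a::topological_space" where "\<And>W. open W \<Longrightarrow> W \<noteq> {} \<Longrightarrow> \<exists>n. s n \<in> W"
proof -
  obtain D :: "'a set" where "countable D" and D: "euclidean closure_of D = UNIV"
    using assms unfolding separable_space_def by auto
  then have "D \<noteq> {}"
    by auto
  have "\<exists>n. from_nat_into D n \<in> W" if "open W" "W \<noteq> {}" for W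
  proof -
    from \<open>W \<noteq> {}\<close> obtain w where "w \<in> W"
      by blast
    moreover have "w \<in> euclidean closure_of D"
      by (simp only: D UNIV_I)
    ultimately obtain y where "y \<in> D" "y \<in> W"
      using \<open>open W\<close> unfolding in_closure_of by auto
    then show ?thesis
      using from_nat_into_surj[OF \<open>countable D\<close>] by metis
  qed
  then show thesis
    by (rule that)
qed

text \<open>Adding \<open>s n\<close> together with its inverse preserves symmetry; taking the
  triple sum afterwards yields the chain inclusion. Both operations preserve property (OB).\<close>

fun enlarge :: "'a::group_add set \<Rightarrow> (nat \<Rightarrow> 'a) \<Rightarrow> nat \<Rightarrow> 'a set" where
  "enlarge A s 0 = A"
| "enlarge A s (Suc n) = triple_sum (enlarge A s n \<union> {s n, - s n})"

lemma subset_enlarge: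
  assumes "0 \<in> A"
  shows "A \<subseteq> enlarge A s n"
proof (induction n)
  case (Suc n)
  have "enlarge A s n \<union> {s n, - s n} \<subseteq> enlarge A s (Suc n)"
    using Suc assms unfolding enlarge.simps by (intro subset_triple_sum) blast
  then show ?case
    using Suc by blast
qed simp

lemma uminus_enlarge:
  assumes "\<And>x. x \<in> A \<Longrightarrow> - x \<in> A" "x \<in> enlarge A s n"
  shows "- x \<in> enlarge A s n"
  using assms(2)
proof (induction n arbitrary: x)
  case (Suc n)
  show ?case
    unfolding enlarge.simps
    by (rule uminus_triple_sum[OF _ Suc.prems[unfolded enlarge.simps]]) (use Suc.IH in auto)
qed (simp add: assms(1))

lemma property_OB_enlarge:
  "property_OB A \<Longrightarrow> property_OB (enlarge A s n)" for A :: "'a::topological_group_add set"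
  by (induction n) (auto intro!: property_OB_triple_sum property_OB_Un_finite simp del: Un_insert_right)

lemma exists_OB_chain:
  assumes "metrizable_space (euclidean :: 'a::topological_group_add topology)"
    and "separable_space (euclidean :: 'a topology)"
    and "local_property_OB TYPE('a)"
  obtains V :: "int \<Rightarrow> 'a::topological_group_add set" where "two_sided_chain V" "\<And>n. property_OB (V n)"
proof -
  obtain U :: "'a set" where U: "0 \<in> interior U" "property_OB U"
    using assms(3) unfolding local_property_OB_def by blast
  obtain B :: "nat \<Rightarrow> 'a set" where B: "\<And>n. open (B n)" "\<And>n. 0 \<in> B n"
    "\<And>W. open W \<Longrightarrow> 0 \<in> W \<Longrightarrow> \<exists>n. B n \<subseteq> W" "\<And>x. x \<noteq> 0 \<Longrightarrow> \<exists>n. x \<notin> B n"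
    using metrizable_countable_basis_0[OF assms(1)] by blast
  obtain s :: "nat \<Rightarrow> 'a" where s: "\<And>W. open W \<Longrightarrow> W \<noteq> {} \<Longrightarrow> \<exists>n. s n \<in> W"
    using separable_dense_sequence[OF assms(2)] by blast
  have refine: "\<exists>Z. (open Z \<and> 0 \<in> Z \<and> (\<forall>x\<in>Z. - x \<in> Z)) \<and> triple_sum Z \<subseteq> W"
    if "open W" "0 \<in> W" for W :: "'a set"
    using open_symmetric_triple_sum_subset[OF that] by metis
  \<comment> \<open>The shrinking half: lying in \<open>interior U\<close> gives property (OB), and
    the additional inclusion in \<open>B n\<close> turns the sets into a basis at the
    identity.\<close>
  have "\<exists>Q. \<forall>n. (open (Q n) \<and> 0 \<in> Q n \<and> (\<forall>x\<in>Q n. - x \<in> Q n) \<and> Q n \<subseteq> interior U) \<and>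
      triple_sum (Q (Suc n)) \<subseteq> Q n \<inter> B n"
  proof (rule dependent_nat_choice)
    show "\<exists>Z. open Z \<and> 0 \<in> Z \<and> (\<forall>x\<in>Z. - x \<in> Z) \<and> Z \<subseteq> interior U"
    proof -
      obtain Z where Z: "open Z" "0 \<in> Z" "\<forall>x\<in>Z. - x \<in> Z" "triple_sum Z \<subseteq> interior U"
        using refine[OF open_interior U(1)] by blast
      then have "Z \<subseteq> interior U"
        using subset_triple_sum[of Z] by blast
      with Z show ?thesis
        by blast
    qed
  next
    fix Y n
    assume "open Y \<and> 0 \<in> Y \<and> (\<forall>x\<in>Y. - x \<in> Y) \<and> Y \<subseteq> interior U"
    then have Y: "open (Y \<inter> B n)" "0 \<in> Y \<inter> B n" "Y \<subseteq> interior U"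
      using B by auto
    obtain Z where Z: "open Z" "0 \<in> Z" "\<forall>x\<in>Z. - x \<in> Z" "triple_sum Z \<subseteq> Y \<inter> B n"
      using refine[OF Y(1,2)] by blast
    then have "Z \<subseteq> interior U"
      using subset_triple_sum[of Z] Y(3) by blast
    with Z show "\<exists>Z. (open Z \<and> 0 \<in> Z \<and> (\<forall>x\<in>Z. - x \<in> Z) \<and> Z \<subseteq> interior U) \<and>
        triple_sum Z \<subseteq> Y \<inter> B n"
      by (intro exI[of _ Z]) blast
  qed
  then obtain Q where Q: "\<And>n. open (Q n)" "\<And>n. 0 \<in> Q n" "\<And>n x. x \<in> Q n \<Longrightarrow> - x \<in> Q n"
      "\<And>n. Q n \<subseteq> interior U" "\<And>n. triple_sum (Q (Suc n)) \<subseteq> Q n \<inter> B n"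
    by blast
  have QB: "Q (Suc n) \<subseteq> B n" for n
    using Q(5)[of n] subset_triple_sum[OF Q(2)[of "Suc n"]] by blast
  \<comment> \<open>The halves are glued at index 0, where \<open>enlarge (Q 0) s 0 = Q 0\<close>;
    hence \<open>V_neg\<close> holds for \<open>n = 0\<close> too.\<close>
  define V where "V n = (if n \<ge> 0 then enlarge (Q 0) s (nat n) else Q (nat (- n)))" for n :: int
  have V_nat: "V (int n) = enlarge (Q 0) s n" for n
    by (simp add: V_def)
  have V_neg: "V (- int n) = Q n" for n
    by (simp add: V_def)
  \<comment> \<open>With \<open>Suc k\<close> in the negative case, adding one leads to
    \<open>- int k\<close>, so the passage from -1 to 0 is covered by \<open>V_neg\<close>.\<close>
  have V_cases: "(\<exists>k. n = int k) \<or> (\<exists>k. n = - int (Suc k))" for n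
    by (cases n) auto
  have "two_sided_chain V"
  proof
    fix n x assume "x \<in> V n"
    then show "- x \<in> V n"
      using Q(3) uminus_enlarge[of "Q 0"] by (auto simp: V_def split: if_splits)
  next
    fix n
    from V_cases[of n] show "triple_sum (V n) \<subseteq> V (n + 1)"
    proof (elim disjE exE)
      fix k assume k: "n = int k"
      then have "n + 1 = int (Suc k)"
        by simp
      then show ?thesis
        by (simp only: k V_nat enlarge.simps) (rule triple_sum_mono, blast)
    next
      fix k assume k: "n = - int (Suc k)"
      then have "n + 1 = - int k"
        by simp
      then show ?thesis
        using Q(5)[of k] by (simp only: k V_neg) blast
    qed
  next
    fix n
    have "\<exists>k. Q k \<subseteq> V n"
      using subset_enlarge[OF Q(2)[of 0]] unfolding V_def by (cases "n \<ge> 0") (simp, blast, auto)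
    then show "0 \<in> interior (V n)"
      using Q(1,2) by (meson interior_maximal subsetD)
  next
    fix x :: 'a
    \<comment> \<open>The points \<open>v\<close> for which \<open>x\<close> lies in the translate
      of \<open>Q 0\<close> by \<open>v\<close> form an open neighbourhood of \<open>x\<close>, so
      the dense sequence meets it.\<close>
    have "open ((\<lambda>v. - v + x) -` Q 0)"
      using Q(1) by (intro open_vimage continuous_intros)
    moreover have "x \<in> (\<lambda>v. - v + x) -` Q 0"
      using Q(2) by simp
    ultimately obtain n where n: "- s n + x \<in> Q 0"
      using s by blast
    let ?E = "enlarge (Q 0) s n \<union> {s n, - s n}"
    have "- s n + x \<in> ?E" "0 \<in> ?E"
      using n subset_enlarge[OF Q(2), of 0 s n] Q(2) by auto
    \<comment> \<open>The identity pads the sum to three terms. Since \<open>s n\<close> is added in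
      forming stage \<open>Suc n\<close>, \<open>x\<close> appears at that stage.\<close>
    then have "s n + (- s n + x) + 0 \<in> triple_sum ?E"
      by (intro triple_sumI) auto
    then have "x \<in> V (int (Suc n))"
      unfolding V_nat by (simp add: add.assoc[symmetric])
    then show "\<exists>n. x \<in> V n" ..
  next
    fix W :: "'a set" assume "open W" "0 \<in> W"
    then obtain n where "B n \<subseteq> W"
      using B(3) by blast
    \<comment> \<open>The index is shifted because \<open>QB\<close> places \<open>Q (Suc n)\<close>
      inside \<open>B n\<close>.\<close>
    then have "V (- int (Suc n)) \<subseteq> W"
      unfolding V_neg using QB by blast
    then show "\<exists>n. V n \<subseteq> W" ..
  next
    fix x :: 'a assume "x \<noteq> 0"
    then obtain n where "x \<notin> B n"
      using B(4) by blast
    then have "x \<notin> V (- int (Suc n))"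
      unfolding V_neg using QB by blast
    then show "\<exists>n. x \<notin> V n" ..
  qed
  moreover have "property_OB (V n)" for n
  proof -
    have "property_OB (Q k)" for k
      using property_OB_subset[OF U(2)] Q(4) interior_subset by blast
    then show ?thesis
      using property_OB_enlarge by (auto simp: V_def)
  qed
  ultimately show thesis
    using that by blast
qed

theorem theorem1:
  assumes "metrizable_space (euclidean :: 'a::topological_group_add topology)"
    and "separable_space (euclidean :: 'a topology)"
  shows "(\<exists>d :: 'a \<Rightarrow> 'a \<Rightarrow> real.
            compatible_metric d \<and> left_invariant d \<and> metrically_proper d)
         \<longleftrightarrow> local_property_OB TYPE('a)"
proof
  assume "local_property_OB TYPE('a)"
  then obtain V :: "int \<Rightarrow> 'a set" where "two_sided_chain V" and OB: "\<And>n. property_OB (V n)"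
    using exists_OB_chain[OF assms] by blast
  then interpret two_sided_chain V
    by simp
  show "\<exists>d :: 'a \<Rightarrow> 'a \<Rightarrow> real. compatible_metric d \<and> left_invariant d \<and> metrically_proper d"
    using compatible_chain_dist left_invariant_chain_dist metrically_proper_chain_dist[OF OB] by blast
qed (use proper_imp_local_OB in blast)

end
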